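(* For even $n\ge 2$ let $\mathcal{JD}_n(q)=\sum_{\pi\in J_n^D}q^{\mathrm{inv}_D(\pi)}$. Then for all even $n\ge 2$, $$\mathcal{JD}_n(q)=2q^{n/2}\prod_{i=1}^{n/2-1}\frac{(1+q^{4i})(1-q^{4i+2})}{1-q^2}.$$
   Context: $S_n^B$ is the group of all bijections $\pi$ of $\{\pm1,\dots,\pm n\}$ with $\pi(-a)=-\pi(a)$ for all $a$ (signed permutations). $S_n^D$ is the subgroup of those $\pi\in S_n^B$ for which $|\{1\le i\le n:\pi(i)<0\}|$ is even. For $\pi\in S_n^D$, $$\mathrm{inv}_D(\pi)=|\{(i,j):1\le i<j\le n,\ \pi(i)>\pi(j)\}|+|\{(i,j):1\le i<j\le n,\ \pi(i)+\pi(j)<0\}|.$$ $I_n^D=\{\pi\in S_n^D:\pi^2=\mathrm{id}\}$ and $J_n^D=\{\pi\in I_n^D:\pi(i)\ne\pm i\text{ for all }1\le i\le n\}$. An empty product equals $1$. *)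

theory Defs
  imports
    "HOL-Combinatorics.Permutations"
    "HOL-Computational_Algebra.Polynomial_Factorial"
begin

definition signed_set :: "nat \<Rightarrow> int set" where
  "signed_set n = {- int n..int n} - {0}"

text \<open>
  Bijections of \<open>signed_set n\<close> are represented by functions on the integers that fix every
  integer outside \<open>signed_set n\<close>, as usual for \<open>permutes\<close>. Thus each bijection has exactly
  one representative, and \<open>\<pi> \<circ> \<pi> = id\<close> expresses that \<open>\<pi>\<close> is an involution.
\<close>

definition SB :: "nat \<Rightarrow> (int \<Rightarrow> int) set" where
  "SB n = {\<pi>. \<pi> permutes signed_set n \<and> (\<forall>a\<in>signed_set n. \<pi> (- a) = - \<pi> a)}"

definition SD :: "nat \<Rightarrow> (int \<Rightarrow> int) set" where
  "SD n = {\<pi> \<in> SB n. even (card {i \<in> {1..int n}. \<pi> i < 0})}"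

definition inv_D :: "nat \<Rightarrow> (int \<Rightarrow> int) \<Rightarrow> nat" where
  "inv_D n \<pi> =
     card {(i, j). 1 \<le> i \<and> i < j \<and> j \<le> int n \<and> \<pi> i > \<pi> j} +
     card {(i, j). 1 \<le> i \<and> i < j \<and> j \<le> int n \<and> \<pi> i + \<pi> j < 0}"

definition ID :: "nat \<Rightarrow> (int \<Rightarrow> int) set" where
  "ID n = {\<pi> \<in> SD n. \<pi> \<circ> \<pi> = id}"

definition JD :: "nat \<Rightarrow> (int \<Rightarrow> int) set" where
  "JD n = {\<pi> \<in> ID n. \<forall>i\<in>{1..int n}. \<pi> i \<noteq> i \<and> \<pi> i \<noteq> - i}"

definition JD_poly :: "nat \<Rightarrow> int poly" where
  "JD_poly n = (\<Sum>\<pi>\<in>JD n. monom 1 (inv_D n \<pi>))"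

text \<open>
  The indeterminate as an element of the field of fractions of the integer polynomial ring.
  Identities whose right-hand sides involve quotients are stated in this field.
\<close>

definition q :: "int poly fract" where
  "q = to_fract [:0, 1:]"

end

theory Submission
  imports Defs
begin

text \<open>
  An element of \<^term>\<open>JD n\<close> is a perfect matching of \<open>{1..n}\<close> in which every pair \<open>{i, j}\<close> carries
  a sign: it stands for \<open>i \<mapsto> j, j \<mapsto> i\<close> or for \<open>i \<mapsto> - j, j \<mapsto> - i\<close>. Each negative pair
  contributes two negative values, so the parity condition of type D holds by itself
  (\<open>JD_eq_signed_matchings\<close>).

  The generating function is computed by removing the pair \<open>{k, m}\<close> that contains the largest
  element \<open>m\<close>. The number of inversions lost in this way does not depend on the rest of the
  matching: the share of a remaining \<open>b\<close> is determined by how \<open>b\<close> and \<open>\<bar>\<pi> b\<bar>\<close> compare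
  with \<open>k\<close>, and \<open>b \<mapsto> \<bar>\<pi> b\<bar>\<close> permutes the remaining elements. With \<open>n\<close> elements in all,
  the loss is \<open>1 + 2 r\<close> for a positive
  pair, \<open>r\<close> being the number of \<open>b > k\<close>, and \<open>1 + 2 (n - 2) + 2 s\<close> for a negative one, \<open>s\<close> being
  the number of \<open>b < k\<close> (\<open>inversions_add_pair\<close>). As \<open>k\<close> runs through the elements below \<open>m\<close>, both
  \<open>r\<close> and \<open>s\<close> take each value in \<open>{0..n - 2}\<close> once, which gives the recursion
  \[ F_n = q (1 + q^{2 (n - 2)}) \Bigl(\sum_{r = 0}^{n - 2} q^{2 r}\Bigr) F_{n - 2}. \]

  The matchings are taken on arbitrary finite sets \<open>A\<close> of positive integers. Removing a pair then
  stays within the class, without relabelling, and that the generating function depends on the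
  size of \<open>A\<close> alone comes out of the same induction (\<open>matching_gf_closed_form\<close>).
\<close>

section \<open>Counting and summation over finite ordered sets\<close>

lemma even_card_involution:
  fixes S :: "'a :: linorder set"
  assumes "finite S" and cl: "\<And>x. x \<in> S \<Longrightarrow> f x \<in> S"
    and inv: "\<And>x. x \<in> S \<Longrightarrow> f (f x) = x" and neq: "\<And>x. x \<in> S \<Longrightarrow> f x \<noteq> x"
  shows "even (card S)"
proof -
  let ?L = "{x\<in>S. x < f x}" and ?R = "{x\<in>S. f x < x}"
  have "bij_betw f ?L ?R"
    by (rule bij_betwI[where g = f]) (auto simp: cl inv)
  then have "card ?L = card ?R"
    by (rule bij_betw_same_card)
  moreover have "S = ?L \<union> ?R"
    using neq by (auto simp: neq_iff)
  then have "card S = card (?L \<union> ?R)"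
    by simp
  moreover have "card (?L \<union> ?R) = card ?L + card ?R"
    using \<open>finite S\<close> by (intro card_Un_disjoint) auto
  ultimately show ?thesis
    by simp
qed

lemma sum_over_ranks_below:
  fixes C :: "'a :: linorder set" and f :: "nat \<Rightarrow> 'b :: comm_monoid_add"
  assumes "finite C"
  shows "(\<Sum>k\<in>C. f (card {b\<in>C. b < k})) = (\<Sum>r<card C. f r)"
  using assms
proof (induction C rule: finite_linorder_max_induct)
  case empty
  then show ?case by simp
next
  case (insert m C)
  have "m \<notin> C"
    using insert.hyps by auto
  have "{b\<in>insert m C. b < k} = {b\<in>C. b < k}" if "k \<in> C" for k
    using insert.hyps that by auto
  moreover have "{b\<in>insert m C. b < m} = C"
    using insert.hyps by auto
  ultimately show ?case
    using insert \<open>m \<notin> C\<close> by (simp add: add.commute)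
qed

lemma sum_over_ranks_above:
  fixes C :: "'a :: linorder set" and f :: "nat \<Rightarrow> 'b :: comm_monoid_add"
  assumes "finite C"
  shows "(\<Sum>k\<in>C. f (card {b\<in>C. k < b})) = (\<Sum>r<card C. f r)"
  using assms
proof (induction C rule: finite_linorder_min_induct)
  case empty
  then show ?case by simp
next
  case (insert m C)
  have "m \<notin> C"
    using insert.hyps by auto
  have "{b\<in>insert m C. k < b} = {b\<in>C. k < b}" if "k \<in> C" for k
    using insert.hyps that by auto
  moreover have "{b\<in>insert m C. m < b} = C"
    using insert.hyps by auto
  ultimately show ?case
    using insert \<open>m \<notin> C\<close> by (simp add: add.commute)
qed

definition sum_increasing_pairs :: "('a :: linorder \<Rightarrow> 'a \<Rightarrow> nat) \<Rightarrow> 'a set \<Rightarrow> nat" where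
  "sum_increasing_pairs f A = (\<Sum>(i, j)\<in>{(i, j). i \<in> A \<and> j \<in> A \<and> i < j}. f i j)"

lemma sum_increasing_pairs_insert:
  assumes "finite B" and "x \<notin> B"
  shows "sum_increasing_pairs f (insert x B) =
    sum_increasing_pairs f B + (\<Sum>b\<in>B. f (min b x) (max b x))"
proof -
  let ?P = "\<lambda>A. {(i, j). i \<in> A \<and> j \<in> A \<and> i < j}"
  let ?g = "\<lambda>b. (min b x, max b x)"
  have fin: "finite (?P B)"
    by (rule finite_subset[of _ "B \<times> B"]) (use assms in auto)
  have "?P (insert x B) = ?P B \<union> ?g ` B"
  proof (intro equalityI subsetI)
    fix p assume "p \<in> ?P (insert x B)"
    then obtain i j where p: "p = (i, j)" "i \<in> insert x B" "j \<in> insert x B" "i < j"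
      by auto
    then consider "i \<in> B" "j \<in> B" | "i = x" "j \<in> B" | "j = x" "i \<in> B"
      by auto
    then show "p \<in> ?P B \<union> ?g ` B"
    proof cases
      case 2
      with p have "p = ?g j" by auto
      with 2 show ?thesis by blast
    next
      case 3
      with p have "p = ?g i" by auto
      with 3 show ?thesis by blast
    qed (use p in auto)
  next
    fix p assume "p \<in> ?P B \<union> ?g ` B"
    then consider "p \<in> ?P B" | b where "b \<in> B" "p = ?g b"
      by blast
    then show "p \<in> ?P (insert x B)"
    proof cases
      case (2 b)
      then have "b < x \<or> x < b"
        using assms(2) by (metis neqE)
      with 2 show ?thesis
        by auto
    qed auto
  qed
  moreover have "inj_on ?g B"
    by (auto simp: inj_on_def min_def max_def split: if_splits)
  moreover have "?P B \<inter> ?g ` B = {}"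
    using assms by (auto simp: min_def max_def split: if_splits)
  ultimately show ?thesis
    using fin assms
    by (simp add: sum_increasing_pairs_def sum.union_disjoint sum.reindex)
qed

lemma sum_increasing_pairs_cong:
  assumes "\<And>i j. i \<in> A \<Longrightarrow> j \<in> A \<Longrightarrow> f i j = g i j"
  shows "sum_increasing_pairs f A = sum_increasing_pairs g A"
  unfolding sum_increasing_pairs_def using assms by (intro sum.cong) auto

section \<open>Signed matchings\<close>

text \<open>
  For a set \<open>A\<close> of positive integers these are the signed perfect matchings of \<open>A\<close>. All
  conditions refer to arbitrary integers \<open>x\<close>, and membership of \<open>\<plusminus> A\<close> is expressed
  through \<open>\<bar>x\<bar>\<close>, so that extending and restricting a matching are pointwise operations.
\<close>

definition signed_matchings :: "int set \<Rightarrow> (int \<Rightarrow> int) set" where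
  "signed_matchings A =
    {\<pi>. \<forall>x. \<pi> (- x) = - \<pi> x \<and> \<pi> (\<pi> x) = x \<and>
      (\<bar>x\<bar> \<notin> A \<longrightarrow> \<pi> x = x) \<and> (\<bar>x\<bar> \<in> A \<longrightarrow> \<bar>\<pi> x\<bar> \<noteq> \<bar>x\<bar>)}"

definition pair_inversions :: "(int \<Rightarrow> int) \<Rightarrow> int \<Rightarrow> int \<Rightarrow> nat" where
  "pair_inversions \<pi> i j = of_bool (\<pi> i > \<pi> j) + of_bool (\<pi> i + \<pi> j < 0)"

definition inversions :: "int set \<Rightarrow> (int \<Rightarrow> int) \<Rightarrow> nat" where
  "inversions A \<pi> = sum_increasing_pairs (pair_inversions \<pi>) A"

lemma signed_matchings_simps:
  assumes "\<pi> \<in> signed_matchings A"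
  shows "\<pi> (- x) = - \<pi> x" and "\<pi> (\<pi> x) = x" and "\<bar>x\<bar> \<notin> A \<Longrightarrow> \<pi> x = x"
    and "\<bar>x\<bar> \<in> A \<Longrightarrow> \<bar>\<pi> x\<bar> \<noteq> \<bar>x\<bar>"
  using assms unfolding signed_matchings_def by auto

lemma abs_signed_matching_in:
  assumes "\<pi> \<in> signed_matchings A" and "\<bar>x\<bar> \<in> A"
  shows "\<bar>\<pi> x\<bar> \<in> A"
  using assms signed_matchings_simps[OF assms(1)] by metis

lemma abs_signed_matching_abs:
  assumes "\<pi> \<in> signed_matchings A"
  shows "\<bar>\<pi> \<bar>x\<bar>\<bar> = \<bar>\<pi> x\<bar>"
  using signed_matchings_simps(1)[OF assms, of x] by (cases "x \<ge> 0") auto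

lemma bij_betw_abs_signed_matching:
  assumes "\<pi> \<in> signed_matchings A" and "A \<subseteq> {0<..}"
  shows "bij_betw (\<lambda>x. \<bar>\<pi> x\<bar>) A A"
proof (rule bij_betwI[where g = "\<lambda>x. \<bar>\<pi> x\<bar>"])
  have pos: "\<bar>x\<bar> = x" if "x \<in> A" for x
    using assms(2) that by auto
  show "(\<lambda>x. \<bar>\<pi> x\<bar>) \<in> A \<rightarrow> A" "(\<lambda>x. \<bar>\<pi> x\<bar>) \<in> A \<rightarrow> A"
    using abs_signed_matching_in[OF assms(1)] pos by auto
  show "\<bar>\<pi> \<bar>\<pi> x\<bar>\<bar> = x" "\<bar>\<pi> \<bar>\<pi> x\<bar>\<bar> = x" if "x \<in> A" for x
    using abs_signed_matching_abs[OF assms(1), of "\<pi> x"] signed_matchings_simps(2)[OF assms(1)] pos that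
    by auto
qed

lemma card_abs_signed_matching:
  assumes "\<pi> \<in> signed_matchings A" and "A \<subseteq> {0<..}"
  shows "card {b\<in>A. P \<bar>\<pi> b\<bar>} = card {b\<in>A. P b}"
proof -
  have bij: "bij_betw (\<lambda>x. \<bar>\<pi> x\<bar>) A A"
    by (rule bij_betw_abs_signed_matching[OF assms])
  have "bij_betw (\<lambda>x. \<bar>\<pi> x\<bar>) {b\<in>A. P \<bar>\<pi> b\<bar>} {b\<in>A. P b}"
  proof (rule bij_betw_subset[OF bij])
    show "(\<lambda>x. \<bar>\<pi> x\<bar>) ` {b\<in>A. P \<bar>\<pi> b\<bar>} = {b\<in>A. P b}"
      using bij_betw_imp_surj_on[OF bij] by (auto simp: image_iff)
  qed auto
  then show ?thesis
    by (rule bij_betw_same_card)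
qed

lemma signed_matching_permutes:
  assumes "\<pi> \<in> signed_matchings A"
  shows "\<pi> permutes {x. \<bar>x\<bar> \<in> A}"
proof (rule bij_imp_permutes)
  show "bij_betw \<pi> {x. \<bar>x\<bar> \<in> A} {x. \<bar>x\<bar> \<in> A}"
    by (rule bij_betwI[where g = \<pi>])
      (auto simp: signed_matchings_simps[OF assms] abs_signed_matching_in[OF assms])
qed (simp add: signed_matchings_simps[OF assms])

lemma finite_signed_matchings:
  assumes "finite A"
  shows "finite (signed_matchings A)"
proof (rule finite_subset)
  show "signed_matchings A \<subseteq> {\<pi>. \<pi> permutes {x. \<bar>x\<bar> \<in> A}}"
    using signed_matching_permutes by blast
  have "{x. \<bar>x\<bar> \<in> A} \<subseteq> A \<union> uminus ` A"
    by (auto simp: abs_if image_iff split: if_splits) (metis minus_minus)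
  then show "finite {\<pi>. \<pi> permutes {x. \<bar>x\<bar> \<in> A}}"
    using assms by (intro finite_permutations) (auto intro: finite_subset)
qed

section \<open>Adding a signed pair to a matching\<close>

definition add_pair :: "int \<Rightarrow> int \<Rightarrow> (int \<Rightarrow> int) \<Rightarrow> int \<Rightarrow> int" where
  "add_pair m t \<pi> x =
    (if x = m then t else if x = - m then - t else if x = t then m else if x = - t then - m
     else \<pi> x)"

text \<open>
  The value \<open>t = \<plusminus> k\<close> at \<open>m\<close> encodes the partner \<open>k\<close> together with the sign of the pair.
  The inverse map resets \<open>\<plusminus> m\<close> and \<open>\<plusminus> k\<close> to fixed points.
\<close>

lemma bij_betw_add_pair:
  assumes "0 < \<bar>t\<bar>" and "0 < m" and "\<bar>t\<bar> \<noteq> m" and "m \<notin> B" and "\<bar>t\<bar> \<notin> B"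
  shows "bij_betw (add_pair m t) (signed_matchings B)
    {\<pi>\<in>signed_matchings (insert m (insert \<bar>t\<bar> B)). \<pi> m = t}"
proof (rule bij_betwI[where g = "\<lambda>\<pi> x. if \<bar>x\<bar> \<in> {m, \<bar>t\<bar>} then x else \<pi> x"])
  let ?A = "insert m (insert \<bar>t\<bar> B)" and ?r = "\<lambda>\<pi> x. if \<bar>x\<bar> \<in> {m, \<bar>t\<bar>} then x else \<pi> x"
  have special: "\<bar>x\<bar> \<in> {m, \<bar>t\<bar>} \<longleftrightarrow> x = m \<or> x = - m \<or> x = t \<or> x = - t" for x
    using assms by auto
  show "add_pair m t \<in> signed_matchings B \<rightarrow> {\<pi>\<in>signed_matchings ?A. \<pi> m = t}"
  proof
    fix \<pi> assume \<pi>: "\<pi> \<in> signed_matchings B"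
    note s = signed_matchings_simps[OF \<pi>]
    have out: "\<bar>\<pi> x\<bar> \<notin> {m, \<bar>t\<bar>}" if "\<bar>x\<bar> \<notin> {m, \<bar>t\<bar>}" for x
      using s(2)[of x] s(3)[of "\<pi> x"] that assms(4,5) by auto
    have "add_pair m t \<pi> (- x) = - add_pair m t \<pi> x \<and>
        add_pair m t \<pi> (add_pair m t \<pi> x) = x \<and>
        (\<bar>x\<bar> \<notin> ?A \<longrightarrow> add_pair m t \<pi> x = x) \<and>
        (\<bar>x\<bar> \<in> ?A \<longrightarrow> \<bar>add_pair m t \<pi> x\<bar> \<noteq> \<bar>x\<bar>)" for x
    proof (cases "\<bar>x\<bar> \<in> {m, \<bar>t\<bar>}")
      case True
      then consider "x = m" | "x = - m" | "x = t" | "x = - t"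
        using special by blast
      then show ?thesis
        using assms by cases (auto simp: add_pair_def)
    next
      case False
      have eq: "add_pair m t \<pi> y = \<pi> y" if "\<bar>y\<bar> \<notin> {m, \<bar>t\<bar>}" for y
        using that assms(1,2) by (auto simp: add_pair_def)
      have "\<bar>- x\<bar> \<notin> {m, \<bar>t\<bar>}"
        using False by simp
      with False out[OF False] show ?thesis
        using s by (simp add: eq)
    qed
    then show "add_pair m t \<pi> \<in> {\<pi>\<in>signed_matchings ?A. \<pi> m = t}"
      by (simp add: signed_matchings_def add_pair_def)
  qed
  have vals: "\<pi> (- m) = - t \<and> \<pi> t = m \<and> \<pi> (- t) = - m"
    if "\<pi> \<in> signed_matchings ?A" "\<pi> m = t" for \<pi>
    using signed_matchings_simps(1,2)[OF that(1)] that(2) by metis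
  show "?r \<in> {\<pi>\<in>signed_matchings ?A. \<pi> m = t} \<rightarrow> signed_matchings B"
  proof
    fix \<pi> assume "\<pi> \<in> {\<pi>\<in>signed_matchings ?A. \<pi> m = t}"
    then have \<pi>: "\<pi> \<in> signed_matchings ?A" and pm: "\<pi> m = t"
      by auto
    note s = signed_matchings_simps[OF \<pi>]
    have out: "\<bar>\<pi> x\<bar> \<notin> {m, \<bar>t\<bar>}" if "\<bar>x\<bar> \<notin> {m, \<bar>t\<bar>}" for x
    proof
      assume "\<bar>\<pi> x\<bar> \<in> {m, \<bar>t\<bar>}"
      then consider "\<pi> x = m" | "\<pi> x = - m" | "\<pi> x = t" | "\<pi> x = - t"
        using special by blast
      then have "x \<in> {t, - t, m, - m}"
        using s(2)[of x] vals[OF \<pi> pm] pm by cases auto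
      then show False
        using that special by auto
    qed
    have "?r \<pi> (- x) = - ?r \<pi> x \<and> ?r \<pi> (?r \<pi> x) = x \<and>
        (\<bar>x\<bar> \<notin> B \<longrightarrow> ?r \<pi> x = x) \<and> (\<bar>x\<bar> \<in> B \<longrightarrow> \<bar>?r \<pi> x\<bar> \<noteq> \<bar>x\<bar>)" for x
    proof (cases "\<bar>x\<bar> \<in> {m, \<bar>t\<bar>}")
      case True
      then show ?thesis
        using assms(4,5) by auto
    next
      case False
      with out[OF False] show ?thesis
        using s by auto
    qed
    then show "?r \<pi> \<in> signed_matchings B"
      unfolding signed_matchings_def by blast
  qed
  show "?r (add_pair m t \<pi>) = \<pi>" if "\<pi> \<in> signed_matchings B" for \<pi>
  proof
    fix x
    show "?r (add_pair m t \<pi>) x = \<pi> x"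
    proof (cases "\<bar>x\<bar> \<in> {m, \<bar>t\<bar>}")
      case True
      then have "\<bar>x\<bar> \<notin> B"
        using assms(4,5) by auto
      with True show ?thesis
        by (simp add: signed_matchings_simps(3)[OF that])
    next
      case False
      then show ?thesis
        using special[of x] by (simp add: add_pair_def)
    qed
  qed
  show "add_pair m t (?r \<pi>) = \<pi>" if "\<pi> \<in> {\<pi>\<in>signed_matchings ?A. \<pi> m = t}" for \<pi>
  proof
    fix x
    from that have \<pi>: "\<pi> \<in> signed_matchings ?A" and pm: "\<pi> m = t"
      by auto
    show "add_pair m t (?r \<pi>) x = \<pi> x"
    proof (cases "\<bar>x\<bar> \<in> {m, \<bar>t\<bar>}")
      case True
      then consider "x = m" | "x = - m" | "x = t" | "x = - t"
        using special by blast
      then show ?thesis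
        using vals[OF \<pi> pm] pm assms(1,2) by cases (simp_all add: add_pair_def)
    next
      case False
      then show ?thesis
        using special[of x] by (simp add: add_pair_def)
    qed
  qed
qed

text \<open>
  Write \<open>k = \<bar>t\<bar>\<close>. Since \<open>m\<close> exceeds every \<open>\<bar>\<pi> b\<bar>\<close>, an element \<open>b\<close> together with the two
  positions \<open>k\<close> and \<open>m\<close> produces, for a positive pair, one inversion if \<open>b > k\<close> and one if
  \<open>\<bar>\<pi> b\<bar> > k\<close>; for a negative pair it produces two inversions, one more if \<open>b < k\<close> and one more
  if \<open>\<bar>\<pi> b\<bar> < k\<close>. The conditions on \<open>\<bar>\<pi> b\<bar>\<close> hold for as many \<open>b\<close> as those on \<open>b\<close>, hence the
  factors \<open>2\<close>. The summand \<open>1\<close> comes from the positions \<open>k\<close> and \<open>m\<close> themselves.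
\<close>

lemma inversions_add_pair:
  assumes "finite B" and pos: "B \<subseteq> {0<..}" and max: "\<And>b. b \<in> B \<Longrightarrow> b < m"
    and t: "0 < \<bar>t\<bar>" "\<bar>t\<bar> < m" "\<bar>t\<bar> \<notin> B" and \<pi>: "\<pi> \<in> signed_matchings B"
  shows "inversions (insert m (insert \<bar>t\<bar> B)) (add_pair m t \<pi>) =
    (if t > 0 then 1 + 2 * card {b\<in>B. t < b} else 1 + 2 * card B + 2 * card {b\<in>B. b < - t})
    + inversions B \<pi>"
proof -
  let ?\<sigma> = "add_pair m t \<pi>" and ?k = "\<bar>t\<bar>"
  let ?w = "pair_inversions ?\<sigma>"
  have mB: "m \<notin> insert ?k B"
    using max t by auto
  have \<sigma>B: "?\<sigma> b = \<pi> b" if "b \<in> B" for b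
    using that pos t max[OF that] by (auto simp: add_pair_def)
  have \<sigma>m: "?\<sigma> m = t"
    by (simp add: add_pair_def)
  have \<sigma>k: "?\<sigma> ?k = (if t > 0 then m else - m)"
    using t by (auto simp: add_pair_def)
  have old: "sum_increasing_pairs ?w B = inversions B \<pi>"
    unfolding inversions_def
    by (rule sum_increasing_pairs_cong) (simp add: pair_inversions_def \<sigma>B)
  have absB: "\<bar>\<pi> b\<bar> \<in> B" if "b \<in> B" for b
    using abs_signed_matching_in[OF \<pi>, of b] that pos by auto
  have bounds: "\<bar>\<pi> b\<bar> < m" "\<bar>\<pi> b\<bar> \<noteq> ?k" "b < m" "b \<noteq> ?k" if "b \<in> B" for b
    using max[OF that] max[OF absB[OF that]] absB[OF that] t(3) that by metis+
  have count: "(\<Sum>b\<in>B. of_bool (P b)) = card {b\<in>B. P b}" for P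
    using assms(1) by (simp add: Int_def)
  have "inversions (insert m (insert ?k B)) ?\<sigma> =
      inversions B \<pi> + (\<Sum>b\<in>B. ?w (min b ?k) (max b ?k)) + (\<Sum>b\<in>insert ?k B. ?w (min b m) (max b m))"
    using mB t assms(1) old
    by (simp add: inversions_def[of "insert m _"] sum_increasing_pairs_insert)
  also have "(\<Sum>b\<in>insert ?k B. ?w (min b m) (max b m)) = ?w ?k m + (\<Sum>b\<in>B. ?w b m)"
  proof -
    have "(\<Sum>b\<in>B. ?w (min b m) (max b m)) = (\<Sum>b\<in>B. ?w b m)"
      using bounds(3) by (intro sum.cong) (simp_all add: min_absorb1 max_absorb2 less_imp_le)
    then show ?thesis
      using t assms(1) by (simp add: min_absorb1 max_absorb2 less_imp_le)
  qed
  also have "?w ?k m = 1"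
    unfolding pair_inversions_def \<sigma>k \<sigma>m using t by (cases "t > 0") auto
  also have "(\<Sum>b\<in>B. ?w (min b ?k) (max b ?k)) =
      (\<Sum>b\<in>B. if t > 0 then of_bool (?k < b) else 1 + of_bool (b < ?k))"
  proof (rule sum.cong)
    fix b assume b: "b \<in> B"
    define y where "y = \<pi> b"
    have "y < m" "- m < y"
      using bounds(1)[OF b] by (auto simp: y_def)
    moreover have "?w (min b ?k) (max b ?k) = (if b < ?k then ?w b ?k else ?w ?k b)"
      using bounds(4)[OF b] by (simp only: min_def max_def order.order_iff_strict) simp
    ultimately show "?w (min b ?k) (max b ?k) =
        (if t > 0 then of_bool (?k < b) else 1 + of_bool (b < ?k))"
      using bounds(4)[OF b] unfolding pair_inversions_def \<sigma>k \<sigma>B[OF b] y_def[symmetric]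
      by (cases "b < ?k"; cases "t > 0") auto
  qed simp
  also have "(\<Sum>b\<in>B. ?w b m) =
      (\<Sum>b\<in>B. if t > 0 then of_bool (?k < \<bar>\<pi> b\<bar>) else 1 + of_bool (\<bar>\<pi> b\<bar> < ?k))"
  proof (rule sum.cong)
    fix b assume b: "b \<in> B"
    define y where "y = \<pi> b"
    have "\<bar>y\<bar> \<noteq> ?k"
      using bounds(2)[OF b] by (simp add: y_def)
    then have "of_bool (y > t) + of_bool (y + t < 0) =
        (if t > 0 then of_bool (?k < \<bar>y\<bar>) else 1 + of_bool (\<bar>y\<bar> < ?k) :: nat)"
      by (cases "t > 0"; cases "y \<ge> 0") (auto simp: of_bool_def)
    then show "?w b m = (if t > 0 then of_bool (?k < \<bar>\<pi> b\<bar>) else 1 + of_bool (\<bar>\<pi> b\<bar> < ?k))"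
      by (simp only: pair_inversions_def \<sigma>m \<sigma>B[OF b] y_def)
  qed simp
  finally show ?thesis
    using card_abs_signed_matching[OF \<pi> pos, of "\<lambda>y. ?k < y"]
      card_abs_signed_matching[OF \<pi> pos, of "\<lambda>y. y < ?k"]
    by (cases "t > 0") (simp_all add: sum_Suc count)
qed

section \<open>The generating function\<close>

definition matching_gf :: "'a :: comm_semiring_1 \<Rightarrow> int set \<Rightarrow> 'a" where
  "matching_gf x A = (\<Sum>\<pi>\<in>signed_matchings A. x ^ inversions A \<pi>)"

lemma matching_gf_empty: "matching_gf x {} = 1"
proof -
  have "signed_matchings {} = {id}"
    by (auto simp: signed_matchings_def)
  then show ?thesis
    by (simp add: matching_gf_def inversions_def sum_increasing_pairs_def)
qed

lemma sum_signed_matchings_fixed_value: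
  fixes x :: "'a :: comm_semiring_1"
  assumes "finite B" and "B \<subseteq> {0<..}" and "\<And>b. b \<in> B \<Longrightarrow> b < m"
    and "0 < \<bar>t\<bar>" "\<bar>t\<bar> < m" "\<bar>t\<bar> \<notin> B" and A: "A = insert m (insert \<bar>t\<bar> B)"
  shows "(\<Sum>\<pi> | \<pi> \<in> signed_matchings A \<and> \<pi> m = t. x ^ inversions A \<pi>) =
    x ^ (if t > 0 then 1 + 2 * card {b\<in>B. t < b} else 1 + 2 * card B + 2 * card {b\<in>B. b < - t})
    * matching_gf x B"
proof -
  have "bij_betw (add_pair m t) (signed_matchings B) {\<pi>\<in>signed_matchings A. \<pi> m = t}"
    unfolding A by (rule bij_betw_add_pair) (use assms in auto)
  then have "(\<Sum>\<pi> | \<pi> \<in> signed_matchings A \<and> \<pi> m = t. x ^ inversions A \<pi>) =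
      (\<Sum>\<pi>\<in>signed_matchings B. x ^ inversions A (add_pair m t \<pi>))"
    by (rule sum.reindex_bij_betw[symmetric])
  also have "\<dots> = (\<Sum>\<pi>\<in>signed_matchings B.
      x ^ (if t > 0 then 1 + 2 * card {b\<in>B. t < b} else 1 + 2 * card B + 2 * card {b\<in>B. b < - t})
      * x ^ inversions B \<pi>)"
    unfolding A
    by (intro sum.cong refl) (simp only: inversions_add_pair[OF assms(1-6)] power_add)
  finally show ?thesis
    by (simp only: matching_gf_def sum_distrib_left)
qed

lemma matching_gf_remove_max:
  fixes x :: "'a :: comm_semiring_1"
  assumes "finite C" and "C \<subseteq> {0<..}" and m: "\<And>c. c \<in> C \<Longrightarrow> c < m" and "0 < m"
  shows "matching_gf x (insert m C) =
    (\<Sum>k\<in>C. (x ^ (1 + 2 * card {b\<in>C. k < b}) +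
       x ^ (1 + 2 * (card C - 1) + 2 * card {b\<in>C. b < k})) * matching_gf x (C - {k}))"
proof -
  let ?A = "insert m C"
  let ?S = "signed_matchings ?A" and ?g = "\<lambda>\<pi>. x ^ inversions ?A \<pi>"
  have fin: "finite ?S"
    using assms(1) by (intro finite_signed_matchings) simp
  have "(\<lambda>\<pi>. \<bar>\<pi> m\<bar>) ` ?S \<subseteq> C"
  proof
    fix y assume "y \<in> (\<lambda>\<pi>. \<bar>\<pi> m\<bar>) ` ?S"
    then obtain \<pi> where \<pi>: "\<pi> \<in> ?S" "y = \<bar>\<pi> m\<bar>"
      by auto
    then show "y \<in> C"
      using abs_signed_matching_in[OF \<pi>(1), of m] signed_matchings_simps(4)[OF \<pi>(1), of m] \<open>0 < m\<close>
      by auto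
  qed
  then have "matching_gf x ?A = (\<Sum>k\<in>C. sum ?g {\<pi>\<in>?S. \<bar>\<pi> m\<bar> = k})"
    unfolding matching_gf_def using fin assms(1) by (intro sum.group[symmetric])
  also have "\<dots> = (\<Sum>k\<in>C. (x ^ (1 + 2 * card {b\<in>C. k < b}) +
       x ^ (1 + 2 * (card C - 1) + 2 * card {b\<in>C. b < k})) * matching_gf x (C - {k}))"
  proof (rule sum.cong)
    fix k assume k: "k \<in> C"
    let ?B = "C - {k}"
    have kpos: "0 < k" "k < m"
      using k assms(2) m by auto
    have A: "?A = insert m (insert k ?B)" and B: "?B \<subseteq> {0<..}"
      using k assms(2) by auto
    have "{\<pi>\<in>?S. \<bar>\<pi> m\<bar> = k} = {\<pi>\<in>?S. \<pi> m = k} \<union> {\<pi>\<in>?S. \<pi> m = - k}"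
      using kpos by auto
    then have "sum ?g {\<pi>\<in>?S. \<bar>\<pi> m\<bar> = k} = sum ?g {\<pi>\<in>?S. \<pi> m = k} + sum ?g {\<pi>\<in>?S. \<pi> m = - k}"
      using fin kpos by (simp add: sum.union_disjoint[symmetric] disjoint_iff)
    also have "sum ?g {\<pi>\<in>?S. \<pi> m = k} = x ^ (1 + 2 * card {b\<in>?B. k < b}) * matching_gf x ?B"
      using sum_signed_matchings_fixed_value[of ?B m k ?A x] assms kpos A B by simp
    also have "sum ?g {\<pi>\<in>?S. \<pi> m = - k} =
        x ^ (1 + 2 * card ?B + 2 * card {b\<in>?B. b < k}) * matching_gf x ?B"
      using sum_signed_matchings_fixed_value[of ?B m "- k" ?A x] assms kpos A B by simp
    also have "{b\<in>?B. k < b} = {b\<in>C. k < b}"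
      by auto
    also have "{b\<in>?B. b < k} = {b\<in>C. b < k}"
      by auto
    also have "card ?B = card C - 1"
      using k by simp
    finally show "sum ?g {\<pi>\<in>?S. \<bar>\<pi> m\<bar> = k} = (x ^ (1 + 2 * card {b\<in>C. k < b}) +
       x ^ (1 + 2 * (card C - 1) + 2 * card {b\<in>C. b < k})) * matching_gf x ?B"
      by (simp only: distrib_right)
  qed simp
  finally show ?thesis .
qed

text \<open>
  By induction the factor \<open>matching_gf x (C - {k})\<close> is the same for all \<open>k\<close>, so in the recursion
  only the two powers of \<open>x\<close> vary with \<open>k\<close>, and they vary through the rank of \<open>k\<close>.
\<close>

lemma matching_gf_closed_form:
  fixes x :: "'a :: comm_semiring_1"
  assumes "finite A" and "A \<subseteq> {0<..}" and "card A = 2 * h"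
  shows "matching_gf x A = (\<Prod>i<h. x * (1 + x ^ (4 * i)) * (\<Sum>r<2 * i + 1. (x\<^sup>2) ^ r))"
  using assms
proof (induction h arbitrary: A)
  case 0
  then show ?case
    by (simp add: matching_gf_empty)
next
  case (Suc h)
  let ?F = "\<Prod>i<h. x * (1 + x ^ (4 * i)) * (\<Sum>r<2 * i + 1. (x\<^sup>2) ^ r)"
  define m where "m = Max A"
  define C where "C = A - {m}"
  have "A \<noteq> {}"
    using Suc.prems by auto
  then have mA: "m \<in> A" and le: "a \<le> m" if "a \<in> A" for a
    using Suc.prems(1) that by (auto simp: m_def)
  obtain a where "a \<in> A"
    using \<open>A \<noteq> {}\<close> by auto
  then have "m \<in> A"
    by (rule mA)
  then have A: "A = insert m C" and C: "finite C" "C \<subseteq> {0<..}" "card C = 2 * h + 1" and "0 < m"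
    using Suc.prems by (auto simp: C_def)
  have less: "c < m" if "c \<in> C" for c
    using that le[of c] by (auto simp: C_def order.order_iff_strict)
  have IH: "matching_gf x (C - {k}) = ?F" if "k \<in> C" for k
    using C that by (intro Suc.IH) auto
  have "matching_gf x A = (\<Sum>k\<in>C. (x ^ (1 + 2 * card {b\<in>C. k < b}) +
       x ^ (1 + 2 * (card C - 1) + 2 * card {b\<in>C. b < k})) * matching_gf x (C - {k}))"
    unfolding A by (rule matching_gf_remove_max[OF C(1,2) less \<open>0 < m\<close>])
  also have "\<dots> = ((\<Sum>k\<in>C. x ^ (1 + 2 * card {b\<in>C. k < b})) +
       (\<Sum>k\<in>C. x ^ (1 + 2 * (card C - 1) + 2 * card {b\<in>C. b < k}))) * ?F"
    unfolding sum.distrib[symmetric] sum_distrib_right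
    by (intro sum.cong refl) (simp only: IH)
  also have "(\<Sum>k\<in>C. x ^ (1 + 2 * card {b\<in>C. k < b})) = (\<Sum>r<2 * h + 1. x ^ (1 + 2 * r))"
    using sum_over_ranks_above[OF C(1), of "\<lambda>r. x ^ (1 + 2 * r)"] C(3) by simp
  also have "(\<Sum>k\<in>C. x ^ (1 + 2 * (card C - 1) + 2 * card {b\<in>C. b < k})) =
      (\<Sum>r<2 * h + 1. x ^ (1 + 4 * h + 2 * r))"
    using sum_over_ranks_below[OF C(1), of "\<lambda>r. x ^ (1 + 2 * (card C - 1) + 2 * r)"] C(3) by simp
  also have "(\<Sum>r<2 * h + 1. x ^ (1 + 2 * r)) + (\<Sum>r<2 * h + 1. x ^ (1 + 4 * h + 2 * r)) =
      x * (1 + x ^ (4 * h)) * (\<Sum>r<2 * h + 1. (x\<^sup>2) ^ r)"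
    unfolding sum_distrib_left sum.distrib[symmetric]
    by (intro sum.cong refl) (simp add: power_add algebra_simps flip: power_mult)
  finally show ?case
    by (simp add: mult.commute)
qed

section \<open>The involutions without fixed points in type D\<close>

text \<open>
  The parity condition holds because \<open>i \<mapsto> - \<pi> i\<close> is an involution without fixed points on the
  positions \<open>i\<close> with \<open>\<pi> i < 0\<close>.
\<close>

lemma JD_eq_signed_matchings: "JD n = signed_matchings {1..int n}"
proof (intro equalityI subsetI)
  have S: "signed_set n = {x. \<bar>x\<bar> \<in> {1..int n}}"
    by (auto simp: signed_set_def)
  {
    fix \<pi> assume "\<pi> \<in> JD n"
    then have perm: "\<pi> permutes signed_set n" and odd: "\<And>a. a \<in> signed_set n \<Longrightarrow> \<pi> (- a) = - \<pi> a"
      and inv: "\<pi> \<circ> \<pi> = id" and nofix: "\<And>i. i \<in> {1..int n} \<Longrightarrow> \<pi> i \<noteq> i \<and> \<pi> i \<noteq> - i"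
      by (auto simp: JD_def ID_def SD_def SB_def)
    have outside: "\<pi> x = x" if "\<bar>x\<bar> \<notin> {1..int n}" for x
      using permutes_not_in[OF perm, of x] that S by auto
    have "\<pi> (- x) = - \<pi> x" for x
      using odd[of x] outside[of x] outside[of "- x"] S by (cases "\<bar>x\<bar> \<in> {1..int n}") auto
    moreover have "\<pi> (\<pi> x) = x" for x
      using inv by (metis comp_apply id_apply)
    moreover have "\<bar>\<pi> x\<bar> \<noteq> \<bar>x\<bar>" if "\<bar>x\<bar> \<in> {1..int n}" for x
      using nofix[OF that] odd[of "\<bar>x\<bar>"] that S by (cases "x \<ge> 0") (auto simp: abs_if split: if_splits)
    ultimately show "\<pi> \<in> signed_matchings {1..int n}"
      using outside by (simp add: signed_matchings_def)
  }
  fix \<pi> assume \<pi>: "\<pi> \<in> signed_matchings {1..int n}"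
  note s = signed_matchings_simps[OF \<pi>]
  have "even (card {i\<in>{1..int n}. \<pi> i < 0})"
  proof (rule even_card_involution[where f = "\<lambda>i. - \<pi> i"])
    fix i assume "i \<in> {i\<in>{1..int n}. \<pi> i < 0}"
    then show "- \<pi> i \<in> {i\<in>{1..int n}. \<pi> i < 0}" "- \<pi> (- \<pi> i) = i" "- \<pi> i \<noteq> i"
      using abs_signed_matching_in[OF \<pi>, of i] s(1,2,4)[of i] s(1)[of "\<pi> i"] by auto
  qed (auto intro: finite_subset[of _ "{1..int n}"])
  moreover have "\<pi> permutes signed_set n"
    using signed_matching_permutes[OF \<pi>] S by simp
  moreover have "\<pi> i \<noteq> i \<and> \<pi> i \<noteq> - i" if "i \<in> {1..int n}" for i
    using s(4)[of i] that by auto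
  ultimately show "\<pi> \<in> JD n"
    using s by (auto simp: JD_def ID_def SD_def SB_def fun_eq_iff)
qed

lemma inv_D_eq_inversions: "inv_D n \<pi> = inversions {1..int n} \<pi>"
proof -
  let ?P = "{(i, j). i \<in> {1..int n} \<and> j \<in> {1..int n} \<and> i < j}"
  have fin: "finite ?P"
    by (rule finite_subset[of _ "{1..int n} \<times> {1..int n}"]) auto
  have count: "(\<Sum>(i, j)\<in>?P. of_bool (Q i j)) = card {(i, j). 1 \<le> i \<and> i < j \<and> j \<le> int n \<and> Q i j}"
    for Q
  proof -
    have "(\<Sum>(i, j)\<in>?P. of_bool (Q i j)) = (\<Sum>p\<in>?P. of_bool (case p of (i, j) \<Rightarrow> Q i j) :: nat)"
      by (intro sum.cong) auto
    also have "\<dots> = card (?P \<inter> {p. case p of (i, j) \<Rightarrow> Q i j})"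
      using fin by simp
    also have "?P \<inter> {p. case p of (i, j) \<Rightarrow> Q i j} = {(i, j). 1 \<le> i \<and> i < j \<and> j \<le> int n \<and> Q i j}"
      by auto
    finally show ?thesis .
  qed
  have "inversions {1..int n} \<pi> =
      (\<Sum>(i, j)\<in>?P. of_bool (\<pi> i > \<pi> j)) + (\<Sum>(i, j)\<in>?P. of_bool (\<pi> i + \<pi> j < 0))"
    by (simp add: inversions_def sum_increasing_pairs_def pair_inversions_def case_prod_unfold sum.distrib)
  then show ?thesis
    by (simp only: inv_D_def count)
qed

lemma to_fract_monom_1: "to_fract (monom 1 k) = q ^ k"
proof (induction k)
  case (Suc k)
  have "monom (1 :: int) (Suc k) = [:0, 1:] * monom 1 k"
    by (simp add: monom_Suc)
  then have "to_fract (monom (1 :: int) (Suc k)) = q * to_fract (monom 1 k)"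
    by (simp only: q_def to_fract_mult)
  with Suc show ?case
    by simp
qed (simp add: monom_0 flip: one_pCons)

lemma to_fract_JD_poly: "to_fract (JD_poly n) = matching_gf q {1..int n}"
  by (simp add: JD_poly_def matching_gf_def JD_eq_signed_matchings inv_D_eq_inversions to_fract_monom_1)

lemma q_square_neq_1: "q\<^sup>2 \<noteq> 1"
proof
  assume "q\<^sup>2 = 1"
  then have "to_fract ([:0, 1:] * [:0, 1:]) = to_fract (1 :: int poly)"
    by (simp only: q_def power2_eq_square to_fract_mult to_fract_1)
  then have "[:0, 1:] * [:0, 1:] = (1 :: int poly)"
    by (simp only: to_fract_eq_iff)
  then show False
    by (simp add: one_pCons)
qed

theorem theorem3p3:
  fixes n :: nat
  assumes "even n" and "n \<ge> 2"
  shows "to_fract (JD_poly n) =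
    2 * q ^ (n div 2) *
      (\<Prod>i = 1..n div 2 - 1. (1 + q ^ (4 * i)) * (1 - q ^ (4 * i + 2)) / (1 - q ^ 2))"
proof -
  let ?f = "\<lambda>i. (1 + q ^ (4 * i)) * (1 - q ^ (4 * i + 2)) / (1 - q ^ 2)"
  obtain h where h: "n = 2 * Suc h"
    using assms by (metis dvdE mult_0_right not_numeral_le_zero old.nat.exhaust)
  have geometric: "(\<Sum>r<2 * i + 1. (q\<^sup>2) ^ r) = (1 - q ^ (4 * i + 2)) / (1 - q ^ 2)" for i
  proof -
    have "1 - (q\<^sup>2) ^ (2 * i + 1) = (1 - q\<^sup>2) * (\<Sum>r<2 * i + 1. (q\<^sup>2) ^ r)"
      by (rule one_diff_power_eq)
    moreover have "(q\<^sup>2) ^ (2 * i + 1) = q ^ (4 * i + 2)"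
      unfolding power_mult[symmetric] by (rule arg_cong) simp
    ultimately show ?thesis
      using q_square_neq_1 by (simp add: field_simps)
  qed
  have "to_fract (JD_poly n) = (\<Prod>i<Suc h. q * (1 + q ^ (4 * i)) * (\<Sum>r<2 * i + 1. (q\<^sup>2) ^ r))"
    unfolding to_fract_JD_poly by (rule matching_gf_closed_form) (auto simp: h)
  also have "\<dots> = (\<Prod>i<Suc h. q * ?f i)"
    by (intro prod.cong refl, subst geometric) simp
  also have "\<dots> = q ^ Suc h * (\<Prod>i<Suc h. ?f i)"
    by (simp only: prod.distrib prod_constant card_lessThan)
  \<comment> \<open>The factor for \<open>i = 0\<close> is the \<open>2\<close> in front of the product.\<close>
  also have "(\<Prod>i<Suc h. ?f i) = ?f 0 * (\<Prod>i = 1..h. ?f i)"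
    by (simp only: prod.lessThan_Suc_shift prod.atLeast1_atMost_eq One_nat_def)
  also have "?f 0 = 2"
  proof -
    have "1 - q\<^sup>2 \<noteq> 0"
      using q_square_neq_1 by simp
    then show ?thesis
      by (simp only: mult_0_right power_0 add_0 one_add_one nonzero_mult_div_cancel_right
          not_False_eq_True)
  qed
  finally show ?thesis
    by (simp add: h mult.commute mult.left_commute)
qed

end
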